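(* Let $p$ be a prime, let $q=p^h$ be a power of $p$ that is not prime, and let $k$ be a positive integer. Let $S$ be a set of vectors of ${\mathbb F}_q^k$ with the property that every subset of $S$ of size $k$ is a basis of ${\mathbb F}_q^k$. If $k \leq 2p-2$ then $|S| \leq q+1$.
   Context: ${\mathbb F}_q$ denotes the finite field with $q$ elements. *)

theory Defs
  imports "HOL-Analysis.Cartesian_Space" "HOL-Computational_Algebra.Primes"
begin

definition is_basis :: "('a::field ^ 'n) set \<Rightarrow> bool" where
  "is_basis B \<longleftrightarrow> vec.independent B \<and> vec.span B = UNIV"

end

theory Submission
  imports Defs "HOL-Analysis.Determinants" "HOL-Number_Theory.Residues"
begin

text \<open>
  Let \<open>S\<close> be an arc of \<open>q + 2\<close> vectors in dimension \<open>k\<close>, and for a \<open>(k-1)\<close>-subset \<open>C\<close> let \<open>n C\<close> be the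
  determinantal linear form with kernel the span of \<open>C\<close>. For a \<open>(2k-3)\<close>-subset \<open>G\<close> of \<open>S\<close> give \<open>C\<close> the
  weight \<open>1 / (\<Prod>s\<in>S - C. n C s) (\<Prod>z\<in>G - C. n C z)\<close>. Lagrange interpolation on the pencil of hyperplanes
  through \<open>k - 2\<close> points \<open>A\<close> of \<open>G\<close> shows that the weights of the \<open>C\<close> with \<open>A \<subset> C \<subseteq> G\<close> add up to zero.

  Write \<open>k - 1 = r + s\<close> with \<open>r \<le> p - 1\<close> and \<open>s < r\<close>, which is possible exactly when \<open>k \<le> 2p - 2\<close>.
  Alternating differences of the weight in \<open>s\<close> disjoint pairs \<open>(a i, b i)\<close> are in the kernel of the
  inclusion matrix of \<open>(r-1)\<close>- against \<open>r\<close>-subsets of a \<open>(2r-1)\<close>-set, which is nonsingular in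
  characteristic \<open>p > r\<close>; hence they vanish. Adding further points of \<open>S\<close> to \<open>G\<close>, they still vanish
  after multiplying the weight of \<open>C\<close> by \<open>n C (a 1) \<dots> n C (a s)\<close>. This factor kills every term but the
  one with all \<open>b i\<close>, which is nonzero, a contradiction.
\<close>

subsection \<open>Kernels of inclusion matrices\<close>

text \<open>The kernel of the inclusion matrix of subsets of size \<open>r\<close> against subsets
  of size \<open>r + 1\<close>. \<open>F\<close> is total, but only its values on the latter
  matter.\<close>

definition inclusion_kernel :: "'v set \<Rightarrow> nat \<Rightarrow> ('v set \<Rightarrow> 'a::ab_group_add) \<Rightarrow> bool" where
  "inclusion_kernel G r F \<longleftrightarrow> (\<forall>A\<subseteq>G. card A = r \<longrightarrow> (\<Sum>e\<in>G - A. F (insert e A)) = 0)"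

text \<open>With \<open>a\<close> or with \<open>b\<close> adjoined to \<open>A\<close>, the
  remaining sum is minus the value at \<open>A\<close> with both adjoined, and this cancels in the
  difference. A ground set of size \<open>2 * (r + 1) + 1\<close> becomes one of size
  \<open>2 * r + 1\<close>, as \<open>inclusion_kernel_eq_0\<close> needs at the next level.\<close>

lemma inclusion_kernel_diff:
  assumes ker: "inclusion_kernel G (Suc r) F" and fin: "finite G"
    and ab: "a \<in> G" "b \<in> G" "a \<noteq> b"
  shows "inclusion_kernel (G - {a, b}) r (\<lambda>C. F (insert a C) - F (insert b C))"
  unfolding inclusion_kernel_def
proof (intro allI impI)
  fix A assume A: "A \<subseteq> G - {a, b}" "card A = r"
  have finA: "finite A" using A fin by (meson finite_Diff finite_subset)
  have nin: "a \<notin> A" "b \<notin> A" using A by auto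
  \<comment> \<open>The sum over all of \<open>G\<close> also has the term for \<open>y\<close>, which is symmetric in \<open>a\<close> and \<open>b\<close>.\<close>
  have step: "(\<Sum>e\<in>G - {a, b} - A. F (insert x (insert e A))) = - F (insert a (insert b A))"
    if xy: "{x, y} = {a, b}" "x \<noteq> y" for x y
  proof -
    have x: "x \<in> G" "y \<in> G" "x \<notin> A" "y \<notin> A" using xy ab nin by (auto simp: doubleton_eq_iff)
    have "(\<Sum>e\<in>G - insert x A. F (insert e (insert x A))) = 0"
    proof -
      have "insert x A \<subseteq> G" "card (insert x A) = Suc r" using A x finA by auto
      then show ?thesis using ker unfolding inclusion_kernel_def by blast
    qed
    moreover have "G - insert x A = insert y (G - {a, b} - A)"
      using xy x by (auto simp: doubleton_eq_iff)
    moreover have "y \<notin> G - {a, b} - A" using xy by auto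
    ultimately have "F (insert y (insert x A)) + (\<Sum>e\<in>G - {a, b} - A. F (insert e (insert x A))) = 0"
      using fin by simp
    moreover have "insert y (insert x A) = insert a (insert b A)"
      using xy by (auto simp: doubleton_eq_iff)
    ultimately show ?thesis by (simp add: insert_commute eq_neg_iff_add_eq_0 add.commute)
  qed
  show "(\<Sum>e\<in>G - {a, b} - A. F (insert a (insert e A)) - F (insert b (insert e A))) = 0"
    using step[of a b] step[of b a] ab by (simp add: sum_subtractf insert_commute)
qed

lemma inclusion_kernel_sum_supersets:
  fixes F :: "'v set \<Rightarrow> 'a::field"
  assumes ker: "inclusion_kernel G r F" and fin: "finite G"
    and char: "\<And>j. 0 < j \<Longrightarrow> j \<le> Suc r \<Longrightarrow> of_nat j \<noteq> (0::'a)"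
    and "B \<subseteq> G" "card B + d = r"
  shows "(\<Sum>C\<in>{C. B \<subseteq> C \<and> C \<subseteq> G \<and> card C = Suc r}. F C) = 0"
  using assms(4,5)
proof (induction d arbitrary: B)
  case 0
  have finB: "finite B" using 0 fin finite_subset by blast
  have "{C. B \<subseteq> C \<and> C \<subseteq> G \<and> card C = Suc r} = (\<lambda>e. insert e B) ` (G - B)"
  proof (intro equalityI subsetI)
    fix C assume "C \<in> {C. B \<subseteq> C \<and> C \<subseteq> G \<and> card C = Suc r}"
    then have C: "B \<subseteq> C" "C \<subseteq> G" "card C = Suc r" by auto
    have "card (C - B) = 1" using C 0 finB by (simp add: card_Diff_subset)
    then obtain e where "C - B = {e}" by (auto simp: card_1_singleton_iff)
    then have "C = insert e B" "e \<in> G - B" using C by auto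
    then show "C \<in> (\<lambda>e. insert e B) ` (G - B)" by blast
  qed (use 0 finB in auto)
  moreover have "inj_on (\<lambda>e. insert e B) (G - B)" by (auto simp: inj_on_def)
  ultimately have "(\<Sum>C\<in>{C. B \<subseteq> C \<and> C \<subseteq> G \<and> card C = Suc r}. F C) = (\<Sum>e\<in>G - B. F (insert e B))"
    by (simp add: sum.reindex)
  then show ?case using ker 0 unfolding inclusion_kernel_def by auto
next
  case (Suc d)
  let ?T = "\<lambda>B. {C. B \<subseteq> C \<and> C \<subseteq> G \<and> card C = Suc r}"
  have finT: "finite (?T B)" using fin by simp
  have finB: "finite B" using Suc.prems fin finite_subset by blast
  \<comment> \<open>Double counting of the pairs of a set \<open>C\<close> and a point
    \<open>x\<close> of \<open>C - B\<close>: the factor is invertible by \<open>char\<close>, and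
    for each \<open>x\<close> the sum over \<open>C\<close> vanishes by induction.\<close>
  have "of_nat (Suc r - card B) * (\<Sum>C\<in>?T B. F C) = (\<Sum>C\<in>?T B. of_nat (card (C - B)) * F C)"
    unfolding sum_distrib_left
    by (rule sum.cong) (auto simp: card_Diff_subset finB)
  also have "\<dots> = (\<Sum>C\<in>?T B. \<Sum>x\<in>{x\<in>G - B. x \<in> C}. F C)"
  proof (rule sum.cong[OF refl])
    fix C assume "C \<in> ?T B"
    then have "C - B = {x\<in>G - B. x \<in> C}" by auto
    then show "of_nat (card (C - B)) * F C = (\<Sum>x\<in>{x\<in>G - B. x \<in> C}. F C)" by simp
  qed
  also have "\<dots> = (\<Sum>x\<in>G - B. \<Sum>C\<in>{C\<in>?T B. x \<in> C}. F C)"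
    by (rule sum.swap_restrict[OF finT]) (use fin in simp)
  also have "\<dots> = (\<Sum>x\<in>G - B. \<Sum>C\<in>?T (insert x B). F C)"
    by (intro sum.cong) auto
  also have "\<dots> = 0"
    by (intro sum.neutral ballI Suc.IH) (use Suc.prems finB in auto)
  finally show ?case using char[of "Suc r - card B"] Suc.prems by auto
qed

text \<open>Inclusion-exclusion over the sets that contain \<open>B\<close> and avoid
  \<open>X\<close>. Their sum vanishes while \<open>B\<close> and \<open>X\<close> have at most
  \<open>r\<close> points together; with one point more it is the value at their union, up to sign.
  For empty \<open>B\<close> and \<open>X = C\<close> the sum is empty, since at most
  \<open>r\<close> points lie outside \<open>C\<close>.\<close>

lemma inclusion_kernel_eq_0:
  fixes F :: "'v set \<Rightarrow> 'a::field"
  assumes ker: "inclusion_kernel G r F" and fin: "finite G" and card: "card G \<le> 2 * r + 1"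
    and char: "\<And>j. 0 < j \<Longrightarrow> j \<le> Suc r \<Longrightarrow> of_nat j \<noteq> (0::'a)"
    and C: "C \<subseteq> G" "card C = Suc r"
  shows "F C = 0"
proof -
  let ?T = "\<lambda>B X. {C. B \<subseteq> C \<and> C \<subseteq> G - X \<and> card C = Suc r}"
  have split: "(\<Sum>C\<in>?T B (insert x X). F C) = (\<Sum>C\<in>?T B X. F C) - (\<Sum>C\<in>?T (insert x B) X. F C)"
    if "x \<notin> X" for B x X
  proof -
    have eq: "?T B X = ?T B (insert x X) \<union> ?T (insert x B) X"
      using that by auto
    have "(\<Sum>C\<in>?T B X. F C) = (\<Sum>C\<in>?T B (insert x X). F C) + (\<Sum>C\<in>?T (insert x B) X. F C)"
      unfolding eq by (rule sum.union_disjoint) (use fin in auto)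
    then show ?thesis by simp
  qed
  have less: "(\<Sum>C\<in>?T B X. F C) = 0"
    if "finite X" "B \<union> X \<subseteq> G" "B \<inter> X = {}" "card B + card X \<le> r" for B X
    using that
  proof (induction X arbitrary: B)
    case empty
    then show ?case
      using inclusion_kernel_sum_supersets[OF ker fin char, of B "r - card B"] by auto
  next
    case (insert x X)
    have "finite B" using insert.prems fin finite_subset by auto
    then have "(\<Sum>C\<in>?T B X. F C) = 0" "(\<Sum>C\<in>?T (insert x B) X. F C) = 0"
      using insert insert.IH[of B] insert.IH[of "insert x B"] by simp_all
    then show ?case by (simp only: split[OF insert.hyps(2)] diff_self)
  qed
  have full: "(\<Sum>C\<in>?T B X. F C) = (-1) ^ card X * F (B \<union> X)"
    if "finite X" "B \<union> X \<subseteq> G" "B \<inter> X = {}" "card B + card X = Suc r" for B X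
    using that
  proof (induction X arbitrary: B)
    case empty
    have "finite B" using empty fin finite_subset by auto
    have "C = B" if "B \<subseteq> C" "C \<subseteq> G" "card C = Suc r" for C
      using that empty card_subset_eq[OF finite_subset[OF that(2) fin] that(1)] by simp
    then have "?T B {} = {B}" using empty by auto
    then show ?case by simp
  next
    case (insert x X)
    have finB: "finite B" using insert.prems fin finite_subset by auto
    have "(\<Sum>C\<in>?T B X. F C) = 0" using insert less by simp
    moreover have "(\<Sum>C\<in>?T (insert x B) X. F C) = (-1) ^ card X * F (insert x B \<union> X)"
      using insert finB by (intro insert.IH) auto
    ultimately show ?case using insert by (simp add: split)
  qed
  have finC: "finite C" using C fin finite_subset by auto
  have small: "card D \<le> r" if "D \<subseteq> G - C" for D
    using card_mono[OF _ that] fin C card finC by (simp add: card_Diff_subset)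
  have "\<not> (D \<subseteq> G - C \<and> card D = Suc r)" for D using small[of D] by auto
  then have empty: "?T {} C = {}" by blast
  have "(- 1) ^ card C * F ({} \<union> C) = 0"
    using full[of C "{}"] C finC unfolding empty by simp
  then show ?thesis by simp
qed

text \<open>Unfolds to the sum of \<open>F\<close> over all ways to adjoin one point of each pair to
  \<open>C\<close>, with a sign change for every second component chosen.\<close>

fun pair_diff :: "('v \<times> 'v) list \<Rightarrow> ('v set \<Rightarrow> 'a::ab_group_add) \<Rightarrow> 'v set \<Rightarrow> 'a" where
  "pair_diff [] F C = F C"
| "pair_diff ((a, b) # ps) F C = pair_diff ps (\<lambda>C. F (insert a C) - F (insert b C)) C"

fun pair_points :: "('v \<times> 'v) list \<Rightarrow> 'v list" where
  "pair_points [] = []"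
| "pair_points ((a, b) # ps) = a # b # pair_points ps"

lemma length_pair_points: "length (pair_points ps) = 2 * length ps"
  by (induction ps rule: pair_points.induct) auto

lemma set_pair_points: "set (pair_points ps) = fst ` set ps \<union> snd ` set ps"
  by (induction ps rule: pair_points.induct) auto

lemma ex_pair_points: "length xs = 2 * s \<Longrightarrow> \<exists>ps. pair_points ps = xs"
proof (induction s arbitrary: xs)
  case 0
  then show ?case by (auto intro: exI[of _ "[]"])
next
  case (Suc s)
  then obtain a b ys where xs: "xs = a # b # ys" "length ys = 2 * s"
    by (auto simp: length_Suc_conv numeral_2_eq_2)
  then obtain ps where "pair_points ps = ys" using Suc.IH by blast
  then have "pair_points ((a, b) # ps) = xs" by (simp add: xs)
  then show ?case by blast
qed

lemma distinct_pair_points: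
  "distinct (pair_points ps) \<Longrightarrow> distinct (map snd ps) \<and> fst ` set ps \<inter> snd ` set ps = {}"
  by (induction ps rule: pair_points.induct) (auto simp: set_pair_points)

lemma inclusion_kernel_pair_diff:
  assumes "inclusion_kernel G (r + length ps) F" "finite G"
    "distinct (pair_points ps)" "set (pair_points ps) \<subseteq> G"
  shows "inclusion_kernel (G - set (pair_points ps)) r (pair_diff ps F)"
  using assms
proof (induction ps arbitrary: F G rule: pair_points.induct)
  case 1
  then show ?case by (simp add: inclusion_kernel_def)
next
  case (2 a b ps)
  have "inclusion_kernel (G - {a, b}) (r + length ps) (\<lambda>C. F (insert a C) - F (insert b C))"
    using 2 by (intro inclusion_kernel_diff) auto
  then have "inclusion_kernel (G - {a, b} - set (pair_points ps)) r
     (pair_diff ps (\<lambda>C. F (insert a C) - F (insert b C)))"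
    using 2 by (intro "2.IH") auto
  moreover have "G - {a, b} - set (pair_points ps) = G - set (pair_points ((a, b) # ps))" by auto
  moreover have "pair_diff ((a, b) # ps) F = pair_diff ps (\<lambda>C. F (insert a C) - F (insert b C))"
    by (rule ext) simp
  ultimately show ?case by simp
qed

lemma pair_diff_sum:
  fixes F :: "'i \<Rightarrow> 'v set \<Rightarrow> 'a::comm_ring"
  shows "pair_diff ps (\<lambda>C. \<Sum>i\<in>I. c i * F i C) R = (\<Sum>i\<in>I. c i * pair_diff ps (F i) R)"
proof (induction ps arbitrary: F)
  case (Cons p ps)
  obtain a b where "p = (a, b)" by force
  moreover have "(\<lambda>C. (\<Sum>i\<in>I. c i * F i (insert a C)) - (\<Sum>i\<in>I. c i * F i (insert b C)))
      = (\<lambda>C. \<Sum>i\<in>I. c i * (F i (insert a C) - F i (insert b C)))"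
    by (simp add: sum_subtractf right_diff_distrib)
  ultimately show ?case using Cons by simp
qed simp

text \<open>Needed because the expansion of a factor \<open>hform C v\<close> is valid only for sets
  \<open>C\<close> containing \<open>R\<close> and disjoint from \<open>Z\<close>.\<close>

lemma pair_diff_cong:
  assumes "\<And>C. R \<subseteq> C \<Longrightarrow> C \<subseteq> R \<union> set (pair_points ps) \<Longrightarrow> F C = F' C"
  shows "pair_diff ps F R = pair_diff ps F' R"
  using assms
proof (induction ps arbitrary: F F')
  case (Cons p ps)
  obtain a b where p: "p = (a, b)" by force
  show ?case unfolding p pair_diff.simps
  proof (rule Cons.IH)
    fix C assume "R \<subseteq> C" "C \<subseteq> R \<union> set (pair_points ps)"
    then show "F (insert a C) - F (insert b C) = F' (insert a C) - F' (insert b C)"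
      by (intro arg_cong2[where f = "(-)"] Cons.prems) (auto simp: p)
  qed
qed simp

text \<open>Every term of the alternating sum but one contains a first component and vanishes; the
  survivor takes all second components.\<close>

lemma pair_diff_eq_0_imp:
  assumes "\<And>a C. a \<in> fst ` set ps \<Longrightarrow> a \<in> C \<Longrightarrow> F C = 0"
    and "pair_diff ps F R = 0"
  shows "F (R \<union> snd ` set ps) = 0"
  using assms
proof (induction ps arbitrary: F)
  case (Cons p ps)
  obtain a b where p: "p = (a, b)" by force
  have "F (insert a (R \<union> snd ` set ps)) - F (insert b (R \<union> snd ` set ps)) = 0"
  proof (rule Cons.IH)
    show "F (insert a C) - F (insert b C) = 0" if "x \<in> fst ` set ps" "x \<in> C" for x C
      using Cons.prems(1)[of x] that by auto
    show "pair_diff ps (\<lambda>C. F (insert a C) - F (insert b C)) R = 0"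
      using Cons.prems(2) p by simp
  qed
  then show ?case using Cons.prems(1)[of a] p by auto
qed simp

subsection \<open>Interpolation on a projective line\<close>

text \<open>A divided difference on \<open>card E\<close> nodes annihilates polynomials of degree
  \<open>card E - 2\<close>. In the induction the new factor \<open>e - \<mu>\<close> is written as
  a combination of \<open>e - a\<close> and \<open>e - b\<close> with nodes \<open>a\<close>,
  \<open>b\<close>; each of these cancels a factor of the denominator and removes its node from
  \<open>E\<close>.\<close>

lemma sum_prod_diff_quotient_eq_0:
  fixes M E :: "'a::field set"
  assumes "finite M" "card E = card M + 2"
  shows "(\<Sum>e\<in>E. (\<Prod>m\<in>M. e - m) / (\<Prod>z\<in>E - {e}. e - z)) = 0"
  using assms
proof (induction M arbitrary: E)
  case empty
  then have "card E = 2" by simp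
  then obtain a b where "E = {a, b}" "a \<noteq> b" by (meson card_2_iff)
  moreover have "{a, b} - {a} = {b}" "{a, b} - {b} = {a}" using \<open>a \<noteq> b\<close> by auto
  ultimately show ?case by (simp add: divide_simps)
next
  case (insert \<mu> M)
  have finE: "finite E" using insert.prems card.infinite by fastforce
  define T where "T e = (\<Prod>m\<in>M. e - m) / (\<Prod>z\<in>E - {e}. e - z)" for e
  have kill: "(\<Sum>e\<in>E. (e - a) * T e) = 0" if a: "a \<in> E" for a
  proof -
    have "(\<Sum>e\<in>E. (e - a) * T e) = (\<Sum>e\<in>E - {a}. (e - a) * T e)"
      using finE a by (simp add: sum.remove)
    also have "\<dots> = (\<Sum>e\<in>E - {a}. (\<Prod>m\<in>M. e - m) / (\<Prod>z\<in>E - {a} - {e}. e - z))"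
    proof (rule sum.cong[OF refl])
      fix e assume e: "e \<in> E - {a}"
      have "(\<Prod>z\<in>E - {e}. e - z) = (e - a) * (\<Prod>z\<in>E - {e} - {a}. e - z)"
        using e a finE by (intro prod.remove) auto
      moreover have "E - {e} - {a} = E - {a} - {e}" by auto
      ultimately show "(e - a) * T e = (\<Prod>m\<in>M. e - m) / (\<Prod>z\<in>E - {a} - {e}. e - z)"
        using e by (simp add: T_def)
    qed
    also have "\<dots> = 0" using insert a finE by (intro insert.IH) auto
    finally show ?thesis .
  qed
  have "2 \<le> card E" using insert.prems by simp
  then obtain a b where ab: "a \<in> E" "b \<in> E" "a \<noteq> b"
    by (metis card_le_Suc0_iff_eq finE not_less_eq_eq numeral_2_eq_2)
  have "(\<Sum>e\<in>E. (\<Prod>m\<in>insert \<mu> M. e - m) / (\<Prod>z\<in>E - {e}. e - z)) = (\<Sum>e\<in>E. (e - \<mu>) * T e)"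
    using insert.hyps by (simp add: T_def)
  also have "\<dots> = (\<Sum>e\<in>E. (\<mu> - b) / (a - b) * ((e - a) * T e) + (a - \<mu>) / (a - b) * ((e - b) * T e))"
  proof (rule sum.cong[OF refl])
    fix e
    have "e - \<mu> = (\<mu> - b) / (a - b) * (e - a) + (a - \<mu>) / (a - b) * (e - b)"
      using ab by (simp add: divide_simps) (simp add: algebra_simps)
    then show "(e - \<mu>) * T e = (\<mu> - b) / (a - b) * ((e - a) * T e) + (a - \<mu>) / (a - b) * ((e - b) * T e)"
      by (metis distrib_right mult.assoc)
  qed
  also have "\<dots> = 0"
    unfolding sum.distrib sum_distrib_left[symmetric] kill[OF ab(1)] kill[OF ab(2)] by simp
  finally show ?case .
qed

section \<open>Elementary facts about finite fields\<close>

lemma prod_diff_finite_field: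
  fixes l :: "'a::{field,finite}"
  shows "(\<Prod>m\<in>UNIV - {l}. l - m) = (\<Prod>x\<in>UNIV - {0}. x)"
  by (rule prod.reindex_bij_witness[of _ "\<lambda>x. l - x" "\<lambda>m. l - m"]) auto

lemma finite_field_power_card:
  fixes x :: "'a::{field,finite}"
  shows "x ^ CARD('a) = x"
proof (cases "x = 0")
  case False
  have "(\<Prod>y\<in>UNIV - {0}. x * y) = (\<Prod>y\<in>UNIV - {0::'a}. y)"
    by (rule prod.reindex_bij_witness[of _ "\<lambda>y. y / x" "\<lambda>y. x * y"]) (use False in auto)
  moreover have "(\<Prod>y\<in>UNIV - {0::'a}. y) \<noteq> 0" by simp
  ultimately have "x ^ (CARD('a) - 1) = 1" by (simp add: prod.distrib card_Diff_subset)
  then show ?thesis using power_minus_mult[of "CARD('a)" x] by simp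
qed simp

text \<open>The characteristic divides the order of the field, so it is a power of \<open>p\<close>
  other than 1 and hence divisible by \<open>p\<close>.\<close>

lemma of_nat_neq_0_prime_power_card:
  assumes "prime p" "CARD('a::{field,finite}) = p ^ h" "0 < j" "j < p"
  shows "of_nat j \<noteq> (0::'a)"
proof
  assume "of_nat j = (0::'a)"
  then have "CHAR('a) dvd j" by (simp add: of_nat_eq_0_iff_char_dvd)
  moreover have "CHAR('a) dvd p ^ h" using CHAR_dvd_CARD[where 'a = 'a] assms by simp
  then obtain i where "CHAR('a) = p ^ i" using assms(1) divides_primepow_nat by blast
  moreover have "i \<noteq> 0" using \<open>CHAR('a) = _\<close> CHAR_not_1'[where 'a = 'a] by (intro notI) simp
  ultimately have "p dvd j" by (metis dvd_power dvd_trans gr0I)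
  then show False using assms by (auto dest: dvd_imp_le)
qed

text \<open>The points of \<open>Y\<close> represent distinct points of a projective line, and \<open>slope a b\<close> is an
  affine coordinate on it with \<open>a\<close> at infinity.\<close>

locale bracket =
  fixes br :: "'v \<Rightarrow> 'v \<Rightarrow> 'a::{field,finite}" and Y :: "'v set"
  assumes finite_Y: "finite Y"
    and antisym: "br x y = - br y x"
    and nonzero: "x \<in> Y \<Longrightarrow> y \<in> Y \<Longrightarrow> x \<noteq> y \<Longrightarrow> br x y \<noteq> 0"
    and exchange: "a \<in> Y \<Longrightarrow> b \<in> Y \<Longrightarrow> a \<noteq> b \<Longrightarrow>
      br x y * br a b = br x b * br a y - br x a * br b y"
begin

definition slope :: "'v \<Rightarrow> 'v \<Rightarrow> 'v \<Rightarrow> 'a" where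
  "slope a b x = br x b / br x a"

text \<open>The three-term Grassmann-Pluecker relation \<open>exchange\<close> turns a bracket into
  a difference of affine coordinates, up to factors that each depend on a single point.\<close>

lemma br_slope:
  assumes "a \<in> Y" "b \<in> Y" "a \<noteq> b" "x \<in> Y - {a}" "y \<in> Y - {a}"
  shows "br x y = br x a * br y a * (slope a b y - slope a b x) / br a b"
proof -
  have nz: "br x a \<noteq> 0" "br y a \<noteq> 0" "br a b \<noteq> 0" using assms nonzero by auto
  have "br x y * br a b = br x b * br a y - br x a * br b y"
    using exchange assms by blast
  also have "\<dots> = br x a * br y b - br x b * br y a"
    using antisym[of a y] antisym[of b y] by simp
  also have "\<dots> = br x a * br y a * (slope a b y - slope a b x)"
    using nz by (simp add: slope_def field_simps)
  finally show ?thesis using nz by (simp add: field_simps)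
qed

lemma inj_on_slope:
  assumes "a \<in> Y" "b \<in> Y" "a \<noteq> b"
  shows "inj_on (slope a b) (Y - {a})"
proof (rule inj_onI, rule ccontr)
  fix x y assume xy: "x \<in> Y - {a}" "y \<in> Y - {a}" "slope a b x = slope a b y" "x \<noteq> y"
  then have "br x y = 0" using br_slope[OF assms xy(1,2)] by simp
  then show False using nonzero xy by auto
qed

text \<open>Away from the point \<open>a\<close> at infinity the coordinates are distinct field
  elements. This also settles dimension two of the theorem.\<close>

lemma card_le: "card Y \<le> CARD('a) + 1"
proof (cases "card Y \<le> 1")
  case False
  then obtain a b where ab: "a \<in> Y" "b \<in> Y" "a \<noteq> b"
    using finite_Y by (metis One_nat_def card_le_Suc0_iff_eq)
  have "card (Y - {a}) \<le> CARD('a)"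
    by (rule card_inj_on_le[OF inj_on_slope[OF ab]]) auto
  then show ?thesis using ab finite_Y by simp
qed simp

text \<open>Since \<open>prod_diff_finite_field\<close> is constant, the product of the \<open>br s e\<close> over \<open>Y\<close> can be traded for
  a product over the slopes missing from \<open>Y\<close>, a polynomial of degree \<open>card E - 2\<close>; the powers of
  \<open>br e a\<close> then disappear because their exponents add up to \<open>CARD('a) - 1\<close>.\<close>

lemma sum_inverse_prod_eq_0:
  assumes E: "E \<subseteq> Y" "card Y + card E = CARD('a) + 3" "2 \<le> card E" and a: "a \<in> Y - E"
  shows "(\<Sum>e\<in>E. inverse ((\<Prod>s\<in>Y - {e}. br s e) * (\<Prod>z\<in>E - {e}. br z e))) = 0"
proof -
  have finE: "finite E" using E finite_Y finite_subset by blast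
  obtain b where b: "b \<in> E" using E(3) by fastforce
  have ab: "a \<in> Y" "b \<in> Y" "a \<noteq> b" using a b E by auto
  define l where "l = slope a b"
  define c where "c = inverse (br a b)"
  define u where "u x = br x a" for x
  have inj: "inj_on l (Y - {a})" unfolding l_def by (rule inj_on_slope[OF ab])
  have EY: "E \<subseteq> Y - {a}" using E a by auto
  have u: "u x \<noteq> 0" if "x \<in> Y - {a}" for x using that ab nonzero by (auto simp: u_def)
  have c: "c \<noteq> 0" using ab nonzero by (simp add: c_def)
  have br: "br x y = c * u x * u y * (l y - l x)" if "x \<in> Y - {a}" "y \<in> Y - {a}" for x y
    using br_slope[OF ab that] by (simp add: c_def u_def l_def divide_inverse mult_ac)
  define M where "M = - l ` (Y - {a})"
  have cardM: "card E = card M + 2"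
  proof -
    have "card (l ` (Y - {a})) = card Y - 1" using inj ab finite_Y by (simp add: card_image)
    moreover have "card Y \<noteq> 0" using ab finite_Y by auto
    moreover have "card Y - 1 \<le> CARD('a)" using card_le by simp
    ultimately show ?thesis using E by (simp add: M_def Compl_eq_Diff_UNIV card_Diff_subset)
  qed
  define w where "w = (\<Prod>x\<in>UNIV - {0::'a}. x)"
  have w: "w \<noteq> 0" by (simp add: w_def)
  \<comment> \<open>\<open>K\<close> collects all factors independent of \<open>e\<close>; its sign
    comes from the bracket of \<open>e\<close> with the point \<open>a\<close> at infinity.\<close>
  define K where "K = - (c ^ (card Y - 2) * (\<Prod>s\<in>Y - {a}. u s) * c ^ (card E - 1) * (\<Prod>z\<in>E. u z))"
  \<comment> \<open>The extra \<open>u e\<close> completes the product of the other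
    \<open>u s\<close> to one over all of \<open>X\<close>, which no longer depends on
    \<open>e\<close>.\<close>
  have term_eq: "(\<Prod>s\<in>X - {e}. br s e) * u e
      = c ^ (card X - 1) * (\<Prod>s\<in>X. u s) * u e ^ (card X - 1) * (\<Prod>s\<in>X - {e}. l e - l s)"
    if X: "X \<subseteq> Y - {a}" and e: "e \<in> X" for X e
  proof -
    have finX: "finite X" using X finite_Y finite_subset by blast
    have "(\<Prod>s\<in>X - {e}. br s e) = (\<Prod>s\<in>X - {e}. c * u s * u e * (l e - l s))"
      using X e by (intro prod.cong refl br) auto
    also have "\<dots> = c ^ (card X - 1) * (\<Prod>s\<in>X - {e}. u s) * u e ^ (card X - 1) * (\<Prod>s\<in>X - {e}. l e - l s)"
      using finX e by (simp add: prod.distrib)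
    finally show ?thesis
      using prod.remove[OF finX e, of u] by (simp add: mult_ac)
  qed
  have cancel: "X * Z = - (c1 * U1 * c2 * U2) * P * R"
    if "X = - (c1 * U1 * v1 * P)" "Z * v = c2 * U2 * v2 * R" "v1 * v2 = v" "v \<noteq> 0"
    for X Z c1 U1 v1 c2 U2 v2 v P R :: 'a
  proof -
    have "X * Z * v = - (c1 * U1 * v1 * P) * (c2 * U2 * v2 * R)"
      using that by (simp only: mult.assoc)
    also have "\<dots> = - (c1 * U1 * c2 * U2) * P * R * (v1 * v2)"
      by (simp add: mult_ac)
    finally show ?thesis using that by simp
  qed
  have quotient: "inverse (K * P * R) = inverse (K * w) * (Q / R)"
    if "w = Q * P" "w \<noteq> 0" for K P R Q w :: 'a
    using that by (auto simp: divide_inverse)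
  have "inverse ((\<Prod>s\<in>Y - {e}. br s e) * (\<Prod>z\<in>E - {e}. br z e))
      = inverse (K * w) * ((\<Prod>m\<in>M. l e - m) / (\<Prod>z\<in>l ` E - {l e}. l e - z))" if e: "e \<in> E" for e
  proof -
    have eY: "e \<in> Y - {a}" using e EY by auto
    have P: "(\<Prod>m\<in>l ` (Y - {a}) - {l e}. l e - m) = (\<Prod>s\<in>Y - {a} - {e}. l e - l s)"
    proof -
      have "l ` (Y - {a}) - {l e} = l ` (Y - {a} - {e})"
        using inj eY by (auto simp: inj_on_def)
      moreover have "inj_on l (Y - {a} - {e})" using inj by (rule inj_on_subset) auto
      ultimately show ?thesis by (simp add: prod.reindex)
    qed
    have R: "(\<Prod>z\<in>l ` E - {l e}. l e - z) = (\<Prod>z\<in>E - {e}. l e - l z)"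
    proof -
      have "l ` E - {l e} = l ` (E - {e})"
        using inj e EY by (auto simp: inj_on_def)
      moreover have "inj_on l (E - {e})" using inj by (rule inj_on_subset) (use EY in auto)
      ultimately show ?thesis by (simp add: prod.reindex)
    qed
    have "w = (\<Prod>m\<in>UNIV - {l e}. l e - m)" by (simp add: w_def prod_diff_finite_field)
    also have "UNIV - {l e} = M \<union> (l ` (Y - {a}) - {l e})" using eY by (auto simp: M_def)
    also have "(\<Prod>m\<in>\<dots>. l e - m) = (\<Prod>m\<in>M. l e - m) * (\<Prod>m\<in>l ` (Y - {a}) - {l e}. l e - m)"
      by (rule prod.union_disjoint) (auto simp: M_def)
    finally have W: "w = (\<Prod>m\<in>M. l e - m) * (\<Prod>s\<in>Y - {a} - {e}. l e - l s)" using P by simp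
    have "br a e = - u e" unfolding u_def by (rule antisym)
    moreover have "(\<Prod>s\<in>Y - {e}. br s e) = br a e * (\<Prod>s\<in>Y - {e} - {a}. br s e)"
      using finite_Y ab eY by (intro prod.remove) auto
    moreover have "Y - {e} - {a} = Y - {a} - {e}" by auto
    ultimately have "(\<Prod>s\<in>Y - {e}. br s e) = - ((\<Prod>s\<in>Y - {a} - {e}. br s e) * u e)"
      by simp
    also have "\<dots> = - (c ^ (card Y - 2) * (\<Prod>s\<in>Y - {a}. u s) * u e ^ (card Y - 2) * (\<Prod>s\<in>Y - {a} - {e}. l e - l s))"
      using term_eq[of "Y - {a}" e] eY ab finite_Y by (simp add: numeral_2_eq_2)
    finally have 1: "(\<Prod>s\<in>Y - {e}. br s e) = \<dots>" .
    have 2: "(\<Prod>z\<in>E - {e}. br z e) * u e = c ^ (card E - 1) * (\<Prod>s\<in>E. u s) * u e ^ (card E - 1) * (\<Prod>s\<in>E - {e}. l e - l s)"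
      using term_eq[OF EY e] .
    have "2 \<le> card Y" using card_mono[OF finite_Y E(1)] E(3) by simp
    \<comment> \<open>The total is \<open>CARD('a)\<close> rather than one less because fact 2 still
      carries a factor \<open>u e\<close> on its left.\<close>
    then have "card Y - 2 + (card E - 1) = CARD('a)" using E by simp
    then have pow: "u e ^ (card Y - 2) * u e ^ (card E - 1) = u e"
      by (simp add: finite_field_power_card flip: power_add)
    have KPR: "(\<Prod>s\<in>Y - {e}. br s e) * (\<Prod>z\<in>E - {e}. br z e)
        = K * (\<Prod>s\<in>Y - {a} - {e}. l e - l s) * (\<Prod>s\<in>E - {e}. l e - l s)"
      unfolding K_def using cancel[OF 1 2 pow u[OF eY]] .
    show ?thesis unfolding KPR R by (rule quotient[OF W w])
  qed
  then have "(\<Sum>e\<in>E. inverse ((\<Prod>s\<in>Y - {e}. br s e) * (\<Prod>z\<in>E - {e}. br z e)))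
      = inverse (K * w) * (\<Sum>e\<in>E. (\<Prod>m\<in>M. l e - m) / (\<Prod>z\<in>l ` E - {l e}. l e - z))"
    by (simp add: sum_distrib_left)
  also have "(\<Sum>e\<in>E. (\<Prod>m\<in>M. l e - m) / (\<Prod>z\<in>l ` E - {l e}. l e - z)) =
      (\<Sum>x\<in>l ` E. (\<Prod>m\<in>M. x - m) / (\<Prod>z\<in>l ` E - {x}. x - z))"
    using inj_on_subset[OF inj EY] by (simp add: sum.reindex)
  also have "\<dots> = 0"
    using cardM card_image[OF inj_on_subset[OF inj EY]] by (intro sum_prod_diff_quotient_eq_0) auto
  finally show ?thesis by simp
qed

end

subsection \<open>Determinants of lists of vectors\<close>

text \<open>The index type carries no order; an arbitrary numbering of it lets lists of vectors
  serve as matrices.\<close>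

definition row_index :: "'n::finite \<Rightarrow> nat" where
  "row_index = (SOME f. bij_betw f UNIV {..<CARD('n)})"

lemma bij_betw_row_index: "bij_betw (row_index :: 'n::finite \<Rightarrow> nat) UNIV {..<CARD('n)}"
proof -
  have "\<exists>f :: 'n \<Rightarrow> nat. bij_betw f UNIV {..<CARD('n)}"
    using ex_bij_betw_finite_nat[of "UNIV :: 'n set"] by (simp add: atLeast0LessThan)
  then show ?thesis unfolding row_index_def by (rule someI_ex)
qed

lemma row_index_less: "row_index (i :: 'n::finite) < CARD('n)"
  using bij_betw_row_index by (auto simp: bij_betw_def)

lemma row_index_eq_iff: "row_index i = row_index j \<longleftrightarrow> i = j"
  using bij_betw_row_index by (auto simp: bij_betw_def inj_on_def)

lemma ex_row_index: "j < CARD('n) \<Longrightarrow> \<exists>i :: 'n::finite. row_index i = j"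
  by (metis bij_betw_row_index bij_betw_imp_surj_on imageE lessThan_iff)

definition vol :: "('a::comm_ring_1 ^ 'n) list \<Rightarrow> 'a" where
  "vol xs = det (\<chi> i. xs ! row_index i)"

text \<open>Only the row \<open>i0\<close> numbered 0 depends on \<open>x\<close>, and linearity of
  \<open>det\<close> in one row applies to it. The \<open>undefined\<close> is a placeholder for
  that row and is never read.\<close>

lemma vol_Cons:
  obtains i0 :: "'n::finite" where
    "\<And>x :: 'a::comm_ring_1 ^ 'n. vol (x # xs) = det (\<chi> i. if i = i0 then x else (undefined # xs) ! row_index i)"
proof -
  obtain i0 :: 'n where "row_index i0 = 0" using ex_row_index[of 0] by auto
  then have "(x # xs) ! row_index i = (if i = i0 then x else (undefined # xs) ! row_index i)"
    for i and x :: "'a ^ 'n"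
    using row_index_eq_iff[of i i0] by (cases "row_index i") auto
  then show ?thesis using that[of i0] by (simp add: vol_def)
qed

lemma vol_Cons_add: "vol ((x + y) # xs) = vol (x # xs) + vol (y # xs)"
proof -
  obtain i0 where v: "\<And>x. vol (x # xs) = det (\<chi> i. if i = i0 then x else (undefined # xs) ! row_index i)"
    using vol_Cons[of xs] by blast
  show ?thesis unfolding v by (rule det_row_add)
qed

lemma vol_Cons_scale: "vol ((c *s x) # xs) = c * vol (x # xs)"
proof -
  obtain i0 where v: "\<And>x. vol (x # xs) = det (\<chi> i. if i = i0 then x else (undefined # xs) ! row_index i)"
    using vol_Cons[of xs] by blast
  show ?thesis unfolding v by (rule det_row_mul)
qed

lemma vol_not_distinct:
  assumes "length xs = CARD('n)" "\<not> distinct xs"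
  shows "vol (xs :: ('a::comm_ring_1 ^ 'n) list) = 0"
proof -
  obtain a b where "a < CARD('n)" "b < CARD('n)" "a \<noteq> b" "xs ! a = xs ! b"
    using assms by (auto simp: distinct_conv_nth)
  then obtain i j :: 'n where "i \<noteq> j" "xs ! row_index i = xs ! row_index j"
    by (metis ex_row_index)
  then show ?thesis unfolding vol_def by (intro det_identical_rows[of i j]) (auto simp: row_def vec_eq_iff)
qed

text \<open>The permutation of positions is carried over to the index type by the inverse of
  \<open>row_index\<close>, which preserves its sign.\<close>

lemma vol_permute_list:
  fixes xs :: "('a::comm_ring_1 ^ 'n) list"
  assumes "length xs = CARD('n)" and p: "p permutes {..<CARD('n)}"
  shows "vol (permute_list p xs) = of_int (sign p) * vol xs"
proof -
  define g :: "nat \<Rightarrow> 'n" where "g = inv_into UNIV row_index"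
  have g: "row_index (g j) = j" if "j < CARD('n)" for j
    using ex_row_index[OF that] unfolding g_def by (metis f_inv_into_f rangeI)
  have bij: "bij_betw g {..<CARD('n)} UNIV"
    unfolding g_def by (rule bij_betw_inv_into[OF bij_betw_row_index])
  define \<sigma> where "\<sigma> = map_permutation {..<CARD('n)} g p"
  have \<sigma>: "\<sigma> permutes UNIV" "sign \<sigma> = sign p"
    unfolding \<sigma>_def using map_permutation_permutes[OF bij p] sign_map_permutation[of g] bij p
    by (auto simp: bij_betw_def)
  have idx: "row_index (\<sigma> i) = p (row_index i)" for i :: 'n
  proof -
    have "g (row_index i) = i" by (simp add: g_def row_index_eq_iff inj_on_def)
    then have "\<sigma> i = \<sigma> (g (row_index i))" by simp
    also have "\<dots> = g (p (row_index i))"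
      unfolding \<sigma>_def by (rule map_permutation_apply) (use bij row_index_less in \<open>auto simp: bij_betw_def\<close>)
    finally show ?thesis
      using g row_index_less[of i] permutes_in_image[OF p, of "row_index i"] by auto
  qed
  have "vol (permute_list p xs) = det (\<chi> i. (\<chi> i. xs ! row_index i) $ \<sigma> i)"
    using assms by (simp add: vol_def idx permute_list_nth row_index_less)
  also have "\<dots> = of_int (sign p) * vol xs"
    unfolding vol_def using det_permute_rows[OF \<sigma>(1), of "\<chi> i. xs ! row_index i"] \<sigma>(2) by simp
  finally show ?thesis .
qed

lemma vol_swap:
  assumes "length xs + 2 = CARD('n)"
  shows "vol (x # y # xs) = - vol (y # x # (xs :: ('a::comm_ring_1 ^ 'n) list))"
proof -
  let ?p = "Transposition.transpose 0 (Suc 0)"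
  have p: "?p permutes {..<CARD('n)}" by (rule permutes_swap_id) (use assms in auto)
  have "permute_list ?p (y # x # xs) = x # y # xs"
  proof (rule nth_equalityI)
    fix i assume "i < length (permute_list ?p (y # x # xs))"
    then show "permute_list ?p (y # x # xs) ! i = (x # y # xs) ! i"
      using permute_list_nth[of ?p "y # x # xs" i] p assms
      by (cases i; cases "i - 1") (auto simp: Transposition.transpose_def)
  qed simp
  then show ?thesis
    using vol_permute_list[OF _ p, of "y # x # xs"] assms by (simp add: sign_swap_id)
qed

text \<open>The permutation of the tail, shifted by one position and fixing 0, does not involve
  \<open>x\<close>; hence a single sign serves all \<open>x\<close>.\<close>

lemma vol_Cons_mset_eq:
  fixes xs ys :: "('a::comm_ring_1 ^ 'n) list"
  assumes "mset xs = mset ys" "length xs + 1 = CARD('n)"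
  obtains \<epsilon> where "\<epsilon> = 1 \<or> \<epsilon> = -1" "\<And>x. vol (x # xs) = \<epsilon> * vol (x # ys)"
proof -
  obtain p where p: "p permutes {..<length ys}" "permute_list p ys = xs"
    using mset_eq_permutation[OF assms(1)] by blast
  define p' where "p' = map_permutation {..<length ys} Suc p"
  have len: "length xs = length ys" using assms(1) by (rule mset_eq_length)
  have img: "Suc ` {..<length ys} \<subseteq> {..<CARD('n)}" using assms(2) len by auto
  have "p' permutes Suc ` {..<length ys}"
    unfolding p'_def by (rule map_permutation_permutes[OF _ p(1)]) (simp add: bij_betw_def)
  then have p': "p' permutes {..<CARD('n)}" using img by (rule permutes_subset)
  have p'0: "p' 0 = 0" using \<open>p' permutes Suc ` _\<close> by (auto simp: permutes_def)
  have p'Suc: "p' (Suc i) = Suc (p i)" if "i < length ys" for i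
    unfolding p'_def by (rule map_permutation_apply) (use that in auto)
  have "permute_list p' (x # ys) = x # xs" for x
  proof (rule nth_equalityI)
    fix i assume i: "i < length (permute_list p' (x # ys))"
    have "permute_list p' (x # ys) ! i = (x # ys) ! p' i"
      using i p' assms(2) len by (intro permute_list_nth) auto
    then show "permute_list p' (x # ys) ! i = (x # xs) ! i"
      using i p p'0 p'Suc by (cases i) (auto simp: permute_list_nth)
  qed (use len in simp)
  then have *: "vol (x # xs) = of_int (sign p') * vol (x # ys)" for x
    using vol_permute_list[OF _ p', of "x # ys"] assms(2) len by auto
  have **: "of_int (sign p') = (1::'a) \<or> of_int (sign p') = (-1::'a)"
    by (simp add: sign_def)
  show ?thesis using that[OF ** *] .
qed

lemma vol_nonzero:
  fixes xs :: "('a::field ^ 'n) list"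
  assumes "length xs = CARD('n)" "is_basis (set xs)"
  shows "vol xs \<noteq> 0"
proof -
  let ?A = "(\<chi> i. xs ! row_index i) :: 'a ^ 'n ^ 'n"
  have "rows ?A = set xs"
  proof -
    have "rows ?A = (\<lambda>i. xs ! row_index i) ` (UNIV :: 'n set)"
      by (auto simp: rows_def row_def)
    also have "\<dots> = (!) xs ` (row_index ` (UNIV :: 'n set))" by (simp add: image_image)
    also have "row_index ` (UNIV :: 'n set) = {..<length xs}"
      using bij_betw_row_index[where 'n = 'n] assms(1) by (simp add: bij_betw_def)
    also have "(!) xs ` {..<length xs} = set xs" by (auto simp: set_conv_nth)
    finally show ?thesis .
  qed
  then have "invertible ?A"
    using assms(2) matrix_left_invertible_span_rows_gen[of ?A]
    by (simp add: is_basis_def invertible_left_inverse)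
  then show ?thesis by (simp add: vol_def invertible_det_nz)
qed

subsection \<open>Arcs\<close>

text \<open>A linear form with kernel the span of \<open>C\<close>. It is determined only up to sign, by the order chosen on
  \<open>C\<close>; the weights below have \<open>CARD('a) + 1\<close> such factors, so the sign cancels
  (\<open>x ^ CARD('a) = x\<close> covers both parities of the characteristic).\<close>

definition hform :: "('a::{field,finite} ^ 'n) set \<Rightarrow> 'a ^ 'n \<Rightarrow> 'a" where
  "hform C x = (if card C + 1 = CARD('n) then vol (x # (SOME xs. distinct xs \<and> set xs = C)) else 0)"

lemma some_distinct_list:
  fixes C :: "'b::finite set"
  shows "distinct (SOME xs. distinct xs \<and> set xs = C)" "set (SOME xs. distinct xs \<and> set xs = C) = C"
proof -
  have "\<exists>xs. distinct xs \<and> set xs = C" using finite_distinct_list[of C] by auto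
  then have "distinct (SOME xs. distinct xs \<and> set xs = C) \<and> set (SOME xs. distinct xs \<and> set xs = C) = C"
    by (rule someI_ex)
  then show "distinct (SOME xs. distinct xs \<and> set xs = C)" "set (SOME xs. distinct xs \<and> set xs = C) = C"
    by auto
qed

lemma vol_Cons_0: "vol (0 # xs) = 0"
  using vol_Cons_scale[of 0 0 xs] by simp

lemma vol_Cons_sum: "vol ((\<Sum>v\<in>B. c v *s v) # xs) = (\<Sum>v\<in>B. c v * vol (v # xs))"
  by (induction B rule: infinite_finite_induct) (simp_all add: vol_Cons_0 vol_Cons_add vol_Cons_scale)

lemma hform_sum: "hform C (\<Sum>v\<in>B. c v *s v) = (\<Sum>v\<in>B. c v * hform C v)"
  by (simp add: hform_def vol_Cons_sum)

lemma hform_eq_0: "x \<in> C \<Longrightarrow> hform C x = 0"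
  unfolding hform_def
  using some_distinct_list[of C] by (auto intro!: vol_not_distinct simp flip: distinct_card)

lemma hform_insert:
  fixes xs :: "('a::{field,finite} ^ 'n) list"
  assumes "distinct (e # xs)" "length xs + 2 = CARD('n)"
  obtains \<epsilon> where "\<epsilon> = 1 \<or> \<epsilon> = -1" "\<And>x. hform (insert e (set xs)) x = \<epsilon> * vol (x # e # xs)"
proof -
  define ys where "ys = (SOME ys. distinct ys \<and> set ys = insert e (set xs))"
  have ys: "distinct ys" "set ys = set (e # xs)"
    unfolding ys_def using some_distinct_list[of "insert e (set xs)"] by auto
  have card: "card (insert e (set xs)) + 1 = CARD('n)"
    using assms distinct_card[of "e # xs"] by simp
  have "length ys + 1 = CARD('n)" using card ys distinct_card[of ys] by simp
  moreover have "mset ys = mset (e # xs)"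
    using ys assms set_eq_iff_mset_eq_distinct by blast
  ultimately obtain \<epsilon> where "\<epsilon> = 1 \<or> \<epsilon> = -1" "\<And>x. vol (x # ys) = \<epsilon> * vol (x # e # xs)"
    using vol_Cons_mset_eq[of ys "e # xs"] by metis
  then show ?thesis using that[of \<epsilon>] card by (simp add: hform_def ys_def)
qed

definition arc :: "('a::field ^ 'n) set \<Rightarrow> bool" where
  "arc S \<longleftrightarrow> (\<forall>T\<subseteq>S. card T = CARD('n) \<longrightarrow> is_basis T)"

lemma arc_expand:
  fixes S :: "('a::{field,finite} ^ 'n) set"
  assumes "arc S" "T \<subseteq> S" "card T = CARD('n)"
  obtains c where "x = (\<Sum>v\<in>T. c v *s v)"
proof -
  have "x \<in> vec.span T" using assms by (simp add: arc_def is_basis_def)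
  then show ?thesis using that by (auto simp: vec.span_finite)
qed

lemma hform_nonzero:
  fixes S :: "('a::{field,finite} ^ 'n) set"
  assumes "arc S" "C \<subseteq> S" "card C + 1 = CARD('n)" "x \<in> S - C"
  shows "hform C x \<noteq> 0"
proof -
  let ?xs = "SOME xs. distinct xs \<and> set xs = C"
  note xs = some_distinct_list[of C]
  have "length (x # ?xs) = CARD('n)" using xs assms distinct_card[of ?xs] by simp
  moreover have "is_basis (insert x C)" using assms by (simp add: arc_def)
  ultimately show ?thesis using assms xs vol_nonzero[of "x # ?xs"] by (simp add: hform_def)
qed

text \<open>Projection from the span of \<open>xs\<close> maps the rest of the arc to distinct
  points of a projective line. The exchange relation follows by expanding \<open>x\<close> in the
  basis formed by \<open>a\<close>, \<open>b\<close> and \<open>xs\<close>.\<close>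

lemma bracket_vol:
  fixes S :: "('a::{field,finite} ^ 'n) set"
  assumes "arc S" "set xs \<subseteq> S" "distinct xs" "length xs + 2 = CARD('n)"
  shows "bracket (\<lambda>x y. vol (x # y # xs)) (S - set xs)"
proof
  have swap: "vol (x # y # xs) = - vol (y # x # xs)" for x y
    by (rule vol_swap) (use assms in simp)
  then show "vol (x # y # xs) = - vol (y # x # xs)" for x y .
  have basis: "card (insert x (insert y (set xs))) = CARD('n)"
    "insert x (insert y (set xs)) \<subseteq> S" if "x \<in> S - set xs" "y \<in> S - set xs" "x \<noteq> y" for x y
    using that assms distinct_card[of xs] by auto
  show "vol (x # y # xs) \<noteq> 0" if "x \<in> S - set xs" "y \<in> S - set xs" "x \<noteq> y" for x y
    using basis[OF that] assms by (intro vol_nonzero) (auto simp: arc_def)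
  show "vol (x # y # xs) * vol (a # b # xs)
      = vol (x # b # xs) * vol (a # y # xs) - vol (x # a # xs) * vol (b # y # xs)"
    if ab: "a \<in> S - set xs" "b \<in> S - set xs" "a \<noteq> b" for a b x y
  proof -
    obtain c where x: "x = (\<Sum>v\<in>insert a (insert b (set xs)). c v *s v)"
      using arc_expand[OF assms(1) basis(2,1)[OF ab]] by blast
    have "vol (v # w # xs) = 0" if "v \<in> set xs" for v w
      using that assms by (intro vol_not_distinct) auto
    then have lin: "vol (x # w # xs) = c a * vol (a # w # xs) + c b * vol (b # w # xs)" for w
      unfolding x vol_Cons_sum using ab by simp
    have same: "vol (w # w # xs) = 0" for w
      using assms by (intro vol_not_distinct) auto
    show ?thesis
      unfolding lin same swap[of b a] by (simp add: algebra_simps)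
  qed
qed simp

section \<open>Weights of hyperplanes and their linear relations\<close>

definition weight :: "('a::{field,finite} ^ 'n) set \<Rightarrow> ('a ^ 'n) set \<Rightarrow> ('a ^ 'n) set \<Rightarrow> 'a" where
  "weight S G C = inverse ((\<Prod>s\<in>S - C. hform C s) * (\<Prod>z\<in>G - C. hform C z))"

text \<open>For fixed \<open>A\<close> the relation is \<open>sum_inverse_prod_eq_0\<close> on the
  line obtained by projecting from \<open>A\<close>: the sizes \<open>CARD('a) + 2 - r\<close> and
  \<open>r + 1\<close> have the required sum, and a point of \<open>S\<close> outside
  \<open>G\<close> serves as infinity.\<close>

lemma inclusion_kernel_weight:
  fixes S :: "('a::{field,finite} ^ 'n) set"
  assumes "arc S" and S: "card S = CARD('a) + 2" and G: "G \<subset> S" "card G = 2 * r + 1"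
    and r: "CARD('n) = r + 2" "0 < r"
  shows "inclusion_kernel G r (weight S G)"
  unfolding inclusion_kernel_def
proof (intro allI impI)
  fix A assume A: "A \<subseteq> G" "card A = r"
  obtain xs where xs: "distinct xs" "set xs = A" using finite_distinct_list[of A] by auto
  have len: "length xs = r" using xs A distinct_card by fastforce
  interpret bracket "\<lambda>x y. vol (x # y # xs)" "S - A"
    using bracket_vol[of S xs] assms xs A len by auto
  have cardY: "card (S - A) = CARD('a) + 2 - r" and cardE: "card (G - A) = r + 1"
    using A G S by (auto simp: card_Diff_subset)
  have "card A \<le> card S" using A G by (intro card_mono) auto
  then have "card (S - A) + card (G - A) = CARD('a) + 3" using cardY cardE S A by simp
  moreover obtain a where "a \<in> S - A - (G - A)" using A G by auto
  ultimately have "(\<Sum>e\<in>G - A. inverse ((\<Prod>s\<in>S - A - {e}. vol (s # e # xs)) * (\<Prod>z\<in>G - A - {e}. vol (z # e # xs)))) = 0"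
    using cardE r G by (intro sum_inverse_prod_eq_0[of _ a]) auto
  moreover have "weight S G (insert e A) = inverse ((\<Prod>s\<in>S - A - {e}. vol (s # e # xs)) * (\<Prod>z\<in>G - A - {e}. vol (z # e # xs)))"
    if e: "e \<in> G - A" for e
  proof -
    obtain \<epsilon> :: 'a where \<epsilon>: "\<epsilon> = 1 \<or> \<epsilon> = -1" "\<And>x. hform (insert e A) x = \<epsilon> * vol (x # e # xs)"
      using hform_insert[of e xs] xs e len r by auto
    have "e \<in> S - A" using e G by auto
    then have "card (S - A) = card (S - A - {e}) + 1" "card (G - A) = card (G - A - {e}) + 1"
      using e card.remove[of "S - A" e] card.remove[of "G - A" e] by simp_all
    then have "card (S - A - {e}) + card (G - A - {e}) = CARD('a) + 1"
      using \<open>card (S - A) + card (G - A) = _\<close> by simp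
    then have pow: "\<epsilon> ^ card (S - A - {e}) * \<epsilon> ^ card (G - A - {e}) = 1"
      using \<epsilon>(1) by (auto simp: finite_field_power_card simp flip: power_add)
    have "S - insert e A = S - A - {e}" "G - insert e A = G - A - {e}" by auto
    then have "weight S G (insert e A) = inverse ((\<epsilon> ^ card (S - A - {e}) * \<epsilon> ^ card (G - A - {e})) *
       ((\<Prod>s\<in>S - A - {e}. vol (s # e # xs)) * (\<Prod>z\<in>G - A - {e}. vol (z # e # xs))))"
      by (simp only: weight_def \<epsilon>(2) prod.distrib prod_constant) (simp only: mult_ac)
    then show ?thesis unfolding pow by simp
  qed
  ultimately show "(\<Sum>e\<in>G - A. weight S G (insert e A)) = 0" by simp
qed

text \<open>A factor \<open>hform C v\<close> is a combination of factors \<open>hform C z\<close> with \<open>z\<close> in \<open>Z\<close>, since \<open>hform C\<close> kills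
  \<open>R\<close>, and \<open>hform C z\<close> cancels against the weight, removing \<open>z\<close> from \<open>Z\<close>.\<close>

lemma pair_diff_weight_eq_0:
  fixes S :: "('a::{field,finite} ^ 'n) set"
  assumes "arc S" and S: "card S = CARD('a) + 2"
    and R: "R \<subseteq> S" "card R = r" and ps: "distinct (pair_points ps)" "set (pair_points ps) \<subseteq> S - R"
    and dim: "CARD('n) = r + length ps + 1" "length ps < r" "1 < r" "2 * CARD('n) < CARD('a) + 5"
    and char: "\<And>j. 0 < j \<Longrightarrow> j \<le> r \<Longrightarrow> of_nat j \<noteq> (0::'a)"
    and Z: "Z \<subseteq> S - R - set (pair_points ps)" "card Z + 1 = r + length vs"
  shows "pair_diff ps (\<lambda>C. weight S (R \<union> set (pair_points ps) \<union> Z) C * (\<Prod>v\<leftarrow>vs. hform C v)) R = 0"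
  using Z
proof (induction vs arbitrary: Z)
  case Nil
  let ?P = "set (pair_points ps)"
  let ?G = "R \<union> ?P \<union> Z"
  have "card ?P = 2 * length ps" using ps by (simp add: distinct_card length_pair_points)
  then have "card ?G = 2 * (r + length ps - 1) + 1" and GP: "card (?G - ?P) = 2 * (r - 1) + 1"
  proof -
    have "card ?G = card (R \<union> ?P) + card Z" using Nil by (intro card_Un_disjoint) auto
    also have "card (R \<union> ?P) = card R + card ?P" using ps by (intro card_Un_disjoint) auto
    finally show G: "card ?G = 2 * (r + length ps - 1) + 1"
      using \<open>card ?P = _\<close> R Nil dim by simp
    have "card (?G - ?P) = card ?G - card ?P" by (rule card_Diff_subset) auto
    then show "card (?G - ?P) = 2 * (r - 1) + 1" using G \<open>card ?P = _\<close> dim by simp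
  qed
  have "?G \<subseteq> S" using R ps Nil by auto
  \<comment> \<open>\<open>G\<close> has \<open>2 * CARD('n) - 3\<close> points, fewer than
    \<open>CARD('a) + 2\<close>.\<close>
  moreover have "?G \<noteq> S" using \<open>card ?G = _\<close> S dim by auto
  ultimately have "inclusion_kernel ?G (r + length ps - 1) (weight S ?G)"
    using \<open>card ?G = _\<close> dim by (intro inclusion_kernel_weight[OF assms(1) S]) auto
  then have "inclusion_kernel (?G - ?P) (r - 1) (pair_diff ps (weight S ?G))"
    using ps dim by (intro inclusion_kernel_pair_diff) auto
  then have "pair_diff ps (weight S ?G) R = 0"
    by (rule inclusion_kernel_eq_0) (use GP char R ps dim in auto)
  then show ?case by simp
next
  case (Cons v vs)
  let ?P = "set (pair_points ps)"
  \<comment> \<open>Here \<open>length ps < r\<close> is essential: \<open>Z\<close> must contain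
    enough points to complete \<open>R\<close> to a basis.\<close>
  have "length ps + 1 \<le> card Z" using Cons.prems dim by simp
  then obtain B where B: "B \<subseteq> Z" "card B = length ps + 1" by (meson obtain_subset_with_card_n)
  have "B \<inter> R = {}" using B Cons.prems by auto
  have "card (B \<union> R) = CARD('n)"
    using B R dim \<open>B \<inter> R = {}\<close> by (subst card_Un_disjoint) auto
  moreover have "B \<union> R \<subseteq> S" using B Cons.prems R by auto
  ultimately obtain c where v: "v = (\<Sum>x\<in>B \<union> R. c x *s x)"
    using arc_expand[OF assms(1)] by blast
  have "pair_diff ps (\<lambda>C. weight S (R \<union> ?P \<union> Z) C * (\<Prod>v\<leftarrow>v # vs. hform C v)) R
      = pair_diff ps (\<lambda>C. \<Sum>z\<in>B. c z * (weight S (R \<union> ?P \<union> (Z - {z})) C * (\<Prod>v\<leftarrow>vs. hform C v))) R"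
  proof (rule pair_diff_cong)
    fix C assume C: "R \<subseteq> C" "C \<subseteq> R \<union> ?P"
    have "hform C v = (\<Sum>x\<in>B. c x * hform C x) + (\<Sum>x\<in>R. c x * hform C x)"
      unfolding v hform_sum by (rule sum.union_disjoint) (use \<open>B \<inter> R = {}\<close> in auto)
    also have "(\<Sum>x\<in>R. c x * hform C x) = 0"
      using C by (intro sum.neutral) (auto simp: hform_eq_0)
    finally have hv: "hform C v = (\<Sum>x\<in>B. c x * hform C x)" by simp
    have drop: "weight S (R \<union> ?P \<union> Z) C * hform C z = weight S (R \<union> ?P \<union> (Z - {z})) C" if z: "z \<in> B" for z
    proof (cases "hform C z = 0")
      case True
      \<comment> \<open>Both sides are then 0, because the product over \<open>S - C\<close>
        vanishes and \<open>inverse 0 = 0\<close>.\<close>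
      have "z \<in> S - C" using z B Cons.prems C by auto
      then have "(\<Prod>s\<in>S - C. hform C s) = 0" using True by (intro prod_zero) auto
      then show ?thesis by (simp add: weight_def)
    next
      case False
      have eq: "R \<union> ?P \<union> Z - C - {z} = R \<union> ?P \<union> (Z - {z}) - C" using z B Cons.prems C by auto
      have "(\<Prod>x\<in>R \<union> ?P \<union> Z - C. hform C x) = hform C z * (\<Prod>x\<in>R \<union> ?P \<union> Z - C - {z}. hform C x)"
        using z B Cons.prems C by (intro prod.remove) auto
      then show ?thesis using False unfolding eq by (simp add: weight_def)
    qed
    have "weight S (R \<union> ?P \<union> Z) C * (\<Prod>v\<leftarrow>v # vs. hform C v)
        = (\<Sum>z\<in>B. c z * (weight S (R \<union> ?P \<union> Z) C * hform C z * (\<Prod>v\<leftarrow>vs. hform C v)))"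
      by (simp add: hv sum_distrib_left sum_distrib_right mult_ac)
    also have "\<dots> = (\<Sum>z\<in>B. c z * (weight S (R \<union> ?P \<union> (Z - {z})) C * (\<Prod>v\<leftarrow>vs. hform C v)))"
      using drop by (intro sum.cong) auto
    finally show "weight S (R \<union> ?P \<union> Z) C * (\<Prod>v\<leftarrow>v # vs. hform C v) = \<dots>" .
  qed
  also have "\<dots> = (\<Sum>z\<in>B. c z * pair_diff ps (\<lambda>C. weight S (R \<union> ?P \<union> (Z - {z})) C * (\<Prod>v\<leftarrow>vs. hform C v)) R)"
    by (rule pair_diff_sum)
  also have "\<dots> = 0"
  proof (rule sum.neutral, rule ballI)
    fix z assume "z \<in> B"
    then have "z \<in> Z" using B by auto
    then have "pair_diff ps (\<lambda>C. weight S (R \<union> ?P \<union> (Z - {z})) C * (\<Prod>v\<leftarrow>vs. hform C v)) R = 0"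
    proof (intro Cons.IH)
      show "Z - {z} \<subseteq> S - R - ?P" using Cons.prems by auto
      have "card Z = Suc (card (Z - {z}))" using \<open>z \<in> Z\<close> by (intro card.remove) auto
      then show "card (Z - {z}) + 1 = r + length vs" using Cons.prems(2) by simp
    qed
    then show "c z * pair_diff ps (\<lambda>C. weight S (R \<union> ?P \<union> (Z - {z})) C * (\<Prod>v\<leftarrow>vs. hform C v)) R = 0"
      by simp
  qed
  finally show ?case .
qed

text \<open>The bound on \<open>2 * r + 3 * s\<close> makes room among \<open>CARD('a) + 2\<close>
  points for disjoint \<open>R\<close>, \<open>P\<close> and \<open>Z\<close> of sizes
  \<open>r\<close>, \<open>2 * s\<close> and \<open>r + s - 1\<close>. The size of \<open>Z\<close>
  allows exactly \<open>s\<close> factors, one for each first component.\<close>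

lemma arc_card_le:
  fixes S :: "('a::{field,finite} ^ 'n) set"
  assumes arc: "arc S" and dim: "CARD('n) = r + s + 1" "s < r" "1 < r"
    and q: "2 * CARD('n) < CARD('a) + 5" "2 * r + 3 * s \<le> CARD('a) + 3"
    and char: "\<And>j. 0 < j \<Longrightarrow> j \<le> r \<Longrightarrow> of_nat j \<noteq> (0::'a)"
  shows "card S \<le> CARD('a) + 1"
proof (rule ccontr)
  assume "\<not> card S \<le> CARD('a) + 1"
  then have "CARD('a) + 2 \<le> card S" by simp
  then obtain S' where S': "S' \<subseteq> S" "card S' = CARD('a) + 2" by (meson obtain_subset_with_card_n)
  have arc': "arc S'" using arc S' by (auto simp: arc_def)
  have "r \<le> card S'" using S' q by simp
  then obtain R where R: "R \<subseteq> S'" "card R = r" by (meson obtain_subset_with_card_n)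
  have "2 * s \<le> card (S' - R)" using R S' q by (simp add: card_Diff_subset)
  then obtain P where P: "P \<subseteq> S' - R" "card P = 2 * s" by (meson obtain_subset_with_card_n)
  obtain xs where xs: "distinct xs" "set xs = P" using finite_distinct_list[of P] by auto
  have "length xs = 2 * s" using xs P distinct_card by fastforce
  then obtain ps where pps: "pair_points ps = xs" using ex_pair_points by blast
  have len: "length ps = s" using \<open>length xs = _\<close> length_pair_points[of ps] pps by simp
  have "card (S' - R - P) = CARD('a) + 2 - r - 2 * s" using R P S' by (simp add: card_Diff_subset)
  then have "r + s - 1 \<le> card (S' - R - P)" using q by simp
  then obtain Z where Z: "Z \<subseteq> S' - R - P" "card Z = r + s - 1" by (meson obtain_subset_with_card_n)
  let ?F = "\<lambda>C. weight S' (R \<union> set (pair_points ps) \<union> Z) C * (\<Prod>v\<leftarrow>map fst ps. hform C v)"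
  have "pair_diff ps ?F R = 0"
    by (rule pair_diff_weight_eq_0[OF arc' S'(2) R]) (use pps xs P Z dim q char len in auto)
  then have zero: "?F (R \<union> snd ` set ps) = 0"
  proof (rule pair_diff_eq_0_imp[rotated])
    fix a C assume "a \<in> fst ` set ps" "a \<in> C"
    then have "0 \<in> set (map (hform C) (map fst ps))" by (force simp: hform_eq_0)
    then have "(\<Prod>v\<leftarrow>map fst ps. hform C v) = 0" by (simp only: prod_list_zero_iff)
    then show "?F C = 0" by simp
  qed
  define C where "C = R \<union> snd ` set ps"
  have dist: "distinct (map snd ps)" "fst ` set ps \<inter> snd ` set ps = {}"
    using distinct_pair_points[of ps] pps xs by auto
  have sub: "fst ` set ps \<subseteq> S' - R" "snd ` set ps \<subseteq> S' - R"
    using set_pair_points[of ps] pps xs P by auto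
  have "card (snd ` set ps) = s" using distinct_card[OF dist(1)] len by simp
  moreover have "card C = card R + card (snd ` set ps)"
    unfolding C_def using sub by (intro card_Un_disjoint) auto
  ultimately have "card C + 1 = CARD('n)" using R dim by simp
  moreover have "C \<subseteq> S'" using R sub by (auto simp: C_def)
  ultimately have nz: "hform C x \<noteq> 0" if "x \<in> S' - C" for x
    using hform_nonzero[OF arc'] that by blast
  have "R \<union> set (pair_points ps) \<union> Z \<subseteq> S'" using R P Z pps xs by auto
  then have "weight S' (R \<union> set (pair_points ps) \<union> Z) C \<noteq> 0"
    using nz by (auto simp: weight_def)
  moreover have "(\<Prod>v\<leftarrow>map fst ps. hform C v) \<noteq> 0"
    using nz sub dist by (force simp: prod_list_zero_iff C_def)
  ultimately show False using zero by (simp add: C_def)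
qed

theorem theorem5p2:
  fixes p q h k :: nat
    and S :: "('a::{field,finite} ^ 'n) set"
  assumes "prime p"
    and "q = p ^ h"
    and "\<not> prime q"
    and "CARD('a) = q"
    and "CARD('n) = k"
    and "\<And>T. T \<subseteq> S \<Longrightarrow> card T = k \<Longrightarrow> is_basis T"
    and "k \<le> 2 * p - 2"
  shows "card S \<le> q + 1"
proof -
  have arc: "arc S" using assms by (simp add: arc_def)
  have p2: "2 \<le> p" using assms(1) prime_ge_2_nat by blast
  have "card {0, 1::'a} \<le> CARD('a)" by (rule card_mono) auto
  then have "2 \<le> q" using assms(4) by simp
  \<comment> \<open>That \<open>q\<close> is not prime enters here, through
    \<open>p ^ 2 \<le> q\<close>.\<close>
  then have "h \<noteq> 0" "h \<noteq> 1" using assms by (auto intro!: notI)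
  then have "p ^ 2 \<le> q" using p2 unfolding assms(2) by (intro power_increasing) auto
  have "0 < k" using assms(5) zero_less_card_finite[where 'a = 'n] by simp
  then consider "k = 1" | "k = 2" | "3 \<le> k" by linarith
  then show ?thesis
  proof cases
    case 1
    have "card S \<le> card (UNIV :: ('a ^ 'n) set)" by (rule card_mono) auto
    also have "\<dots> = q" using 1 assms by simp
    finally show ?thesis by simp
  next
    case 2
    interpret bracket "\<lambda>x y. vol (x # y # [])" "S - set []"
      by (rule bracket_vol) (use arc 2 assms in auto)
    show ?thesis using card_le assms by simp
  next
    case 3
    \<comment> \<open>The largest \<open>r\<close> below \<open>p\<close>, so that
      \<open>char\<close> holds. Either \<open>s = 0\<close>, or \<open>r = p - 1\<close> and
      \<open>s = k - p \<le> p - 2 < r\<close>.\<close>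
    define r where "r = min (k - 1) (p - 1)"
    define s where "s = k - 1 - r"
    have p3: "3 \<le> p" using 3 assms(7) by linarith
    \<comment> \<open>Both size conditions reduce to this: \<open>2 * r + 3 * s\<close> is at most
      \<open>5 * p - 8\<close>, and \<open>2 * k\<close> at most \<open>4 * p - 4\<close>.\<close>
    have bound: "5 * p \<le> q + 8"
    proof -
      have "0 \<le> (int p - 3) * (int p - 2)" using p3 by simp
      then have "int (5 * p) \<le> int (p ^ 2 + 6)" by (simp add: algebra_simps power2_eq_square)
      then show ?thesis using \<open>p ^ 2 \<le> q\<close> by linarith
    qed
    have rs: "k = r + s + 1" "s < r" "1 < r" "r \<le> p - 1" "s \<le> p - 2"
      using 3 p3 assms(7) by (auto simp: r_def s_def min_def)
    have "card S \<le> CARD('a) + 1"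
    proof (rule arc_card_le[OF arc _ rs(2,3)])
      show "CARD('n) = r + s + 1" using rs assms by simp
      show "2 * CARD('n) < CARD('a) + 5" using assms(4,5,7) bound p3 by linarith
      show "2 * r + 3 * s \<le> CARD('a) + 3" using rs(4,5) assms(4) bound p3 by linarith
      show "of_nat j \<noteq> (0::'a)" if "0 < j" "j \<le> r" for j
        using of_nat_neq_0_prime_power_card[where 'a = 'a, OF assms(1) _ that(1)] assms(2,4) that(2) rs(4) p3
        by simp
    qed
    then show ?thesis using assms by simp
  qed
qed

end
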